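(* Let $M$ be a free abelian group generated by $X_1,\dots,X_n$, and let $\mathbb{B}[X_1^{\pm},\dots,X_n^{\pm}]$ be the Laurent polynomial semiring over $\mathbb{B}$. There is a bijection between the set $\operatorname{CSpec}\mathbb{B}[X_1^{\pm},\dots,X_n^{\pm}]$ of all prime congruences on $\mathbb{B}[X_1^{\pm},\dots,X_n^{\pm}]$ and the set $\mathcal{F}_M$ of all $M$-flags.
   Context: $\mathbb{B}=\{-\infty,0\}$ is the semifield with addition $\oplus=\max$ and multiplication $\odot=+$ (additive identity $-\infty$, multiplicative identity $0$). Elements of $\mathbb{B}[X_1^{\pm},\dots,X_n^{\pm}]$ are finite formal sums of distinct Laurent monomials $X^u$, $u\in M\cong\mathbb{Z}^n$ (i.e. finite subsets of $M$, with addition the union and multiplication the elementwise sum). A congruence on a commutative semiring $S$ is a subsemiring $C\subseteq S\times S$ which is an equivalence relation on $S$. It is prime if $(S\times S)\setminus C$ is nonempty and closed under the twisted product $(a,b)\rtimes(c,d)=(ac+bd,\ ad+bc)$. $\operatorname{CSpec}S$ is the set of all prime congruences on $S$. Write $M_{\mathbb{R}}=M\otimes_{\mathbb{Z}}\mathbb{R}\cong\mathbb{R}^n$, and $\mathbb{R}A$ for the linear span of a subset $A$. An orientation of a linear hyperplane $\{v\in V\mid\ell(v)=0\}$ of a real vector space $V$ is one of the two sets $\{v\in V\mid\ell(v)>0\}$, $\{v\in V\mid\ell(v)<0\}$. An $M$-flag is a collection of the following data: an integer $l\ge0$; a family of linear subspaces $M_{\mathbb{R}}=H_0\supsetneq H_1\supsetneq\dots\supsetneq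 H_l$ of $M_{\mathbb{R}}$ such that $H_i$ is a hyperplane of $\mathbb{R}(H_{i-1}\cap M)$ for each $i\in\{1,\dots,l\}$; and an orientation $H_{i,+}\subseteq\mathbb{R}(H_{i-1}\cap M)$ of $H_i$ as a hyperplane for each $i\in\{1,\dots,l\}$. *)

theory Defs
  imports "HOL-Analysis.Analysis" "HOL-Library.Poly_Mapping"
begin

subsection \<open>The Boolean semifield and Laurent polynomials over it\<close>

text \<open>
  In the type class notation, the additive identity \<open>0\<close> of \<open>boolean_semifield\<close> is the element
  \<open>-\<infinity>\<close>, and the multiplicative identity \<open>1\<close> is the real number zero.
\<close>

typedef boolean_semifield = "{-\<infinity>, 0 :: ereal}"
  by blast

setup_lifting type_definition_boolean_semifield

instantiation boolean_semifield :: comm_semiring_1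
begin

lift_definition zero_boolean_semifield :: boolean_semifield is "-\<infinity>"
  by simp

lift_definition one_boolean_semifield :: boolean_semifield is 0
  by simp

lift_definition plus_boolean_semifield ::
  "boolean_semifield \<Rightarrow> boolean_semifield \<Rightarrow> boolean_semifield" is max
  by (auto simp: max_def)

lift_definition times_boolean_semifield ::
  "boolean_semifield \<Rightarrow> boolean_semifield \<Rightarrow> boolean_semifield" is "(+)"
  by auto

instance
  by standard (transfer; auto simp: max_def)+

end

lemma boolean_semifield_cases: "(a :: boolean_semifield) = 0 \<or> a = 1"
  by transfer auto

lemma boolean_semifield_add_eq_0_iff: "(a :: boolean_semifield) + b = 0 \<longleftrightarrow> a = 0 \<and> b = 0"
  by transfer (auto simp: max_def)

text \<open>
  The exponent group is \<open>M = \<int>\<^sup>n\<close>, with \<open>X\<^sub>1, \<dots>, X\<^sub>n\<close> corresponding to the standard basis; the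
  monomial \<open>X\<^sup>u\<close> is \<open>Poly_Mapping.single u 1\<close>.
\<close>

type_synonym 'n boolean_laurent = "(int ^ 'n) \<Rightarrow>\<^sub>0 boolean_semifield"

text \<open>
  Identifying a Laurent polynomial with its support turns the semiring operations into union
  and elementwise sum of finite subsets of \<open>M\<close>.
\<close>

lemma inj_keys_boolean_laurent: "inj (Poly_Mapping.keys :: 'n::finite boolean_laurent \<Rightarrow> _)"
proof (rule injI)
  fix p q :: "'n boolean_laurent"
  assume eq: "Poly_Mapping.keys p = Poly_Mapping.keys q"
  show "p = q"
  proof (rule poly_mapping_eqI)
    fix u
    show "Poly_Mapping.lookup p u = Poly_Mapping.lookup q u"
      using eq boolean_semifield_cases[of "Poly_Mapping.lookup p u"]
        boolean_semifield_cases[of "Poly_Mapping.lookup q u"]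
      by (metis in_keys_iff)
  qed
qed

lemma keys_add_boolean_laurent:
  fixes p q :: "'n::finite boolean_laurent"
  shows "Poly_Mapping.keys (p + q) = Poly_Mapping.keys p \<union> Poly_Mapping.keys q"
  by (auto simp: in_keys_iff lookup_add boolean_semifield_add_eq_0_iff)

lemma keys_mult_boolean_laurent:
  fixes p q :: "'n::finite boolean_laurent"
  shows "Poly_Mapping.keys (p * q) =
    {u + v |u v. u \<in> Poly_Mapping.keys p \<and> v \<in> Poly_Mapping.keys q}"
proof (intro antisym subsetI)
  fix w assume "w \<in> Poly_Mapping.keys (p * q)"
  then show "w \<in> {u + v |u v. u \<in> Poly_Mapping.keys p \<and> v \<in> Poly_Mapping.keys q}"
    using keys_mult[of p q] by auto
next
  have absorb: "r = Poly_Mapping.single u 1 + r"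
    if "u \<in> Poly_Mapping.keys r" for r :: "'n boolean_laurent" and u
    using that by (intro injD[OF inj_keys_boolean_laurent]) (auto simp: keys_add_boolean_laurent)
  fix w assume "w \<in> {u + v |u v. u \<in> Poly_Mapping.keys p \<and> v \<in> Poly_Mapping.keys q}"
  then obtain u v where w: "w = u + v"
    and "u \<in> Poly_Mapping.keys p" "v \<in> Poly_Mapping.keys q"
    by blast
  then have "p * q = (Poly_Mapping.single u 1 + p) * (Poly_Mapping.single v 1 + q)"
    using absorb by metis
  also have "\<dots> = Poly_Mapping.single w 1 + (Poly_Mapping.single u 1 * q + p * (Poly_Mapping.single v 1 + q))"
    by (simp add: w distrib_left distrib_right mult_single ac_simps)
  finally show "w \<in> Poly_Mapping.keys (p * q)"
    by (simp add: keys_add_boolean_laurent)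
qed

subsection \<open>Prime congruences\<close>

definition congruence :: "('a::comm_semiring_1 \<times> 'a) set \<Rightarrow> bool" where
  "congruence C \<longleftrightarrow>
     equiv UNIV C \<and>
     (0, 0) \<in> C \<and> (1, 1) \<in> C \<and>
     (\<forall>(a, b)\<in>C. \<forall>(c, d)\<in>C. (a + c, b + d) \<in> C \<and> (a * c, b * d) \<in> C)"

definition twisted_product :: "'a::comm_semiring_1 \<times> 'a \<Rightarrow> 'a \<times> 'a \<Rightarrow> 'a \<times> 'a" where
  "twisted_product = (\<lambda>(a, b) (c, d). (a * c + b * d, a * d + b * c))"

definition prime_congruence :: "('a::comm_semiring_1 \<times> 'a) set \<Rightarrow> bool" where
  "prime_congruence C \<longleftrightarrow>
     congruence C \<and> - C \<noteq> {} \<and> (\<forall>x\<in>- C. \<forall>y\<in>- C. twisted_product x y \<in> - C)"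

definition CSpec :: "('a::comm_semiring_1 \<times> 'a) set set" where
  "CSpec = {C. prime_congruence C}"

subsection \<open>Flags\<close>

definition lattice_points :: "(real ^ 'n) set" where
  "lattice_points = range (\<lambda>u :: int ^ 'n. \<chi> i. of_int (u $ i))"

text \<open>
  A linear form on a subspace \<open>V\<close> is represented by an extension to the ambient space; it is
  nonzero as a form on \<open>V\<close> if it does not vanish identically on \<open>V\<close>.
\<close>

definition hyperplane_in :: "'v::real_vector set \<Rightarrow> 'v set \<Rightarrow> bool" where
  "hyperplane_in V H \<longleftrightarrow>
     (\<exists>\<phi> :: 'v \<Rightarrow> real. linear \<phi> \<and> (\<exists>v\<in>V. \<phi> v \<noteq> 0) \<and> H = {v \<in> V. \<phi> v = 0})"

definition orientation_in :: "'v::real_vector set \<Rightarrow> 'v set \<Rightarrow> 'v set \<Rightarrow> bool" where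
  "orientation_in V H P \<longleftrightarrow>
     (\<exists>\<phi> :: 'v \<Rightarrow> real. linear \<phi> \<and> (\<exists>v\<in>V. \<phi> v \<noteq> 0) \<and> H = {v \<in> V. \<phi> v = 0} \<and>
        (P = {v \<in> V. \<phi> v > 0} \<or> P = {v \<in> V. \<phi> v < 0}))"

text \<open>
  A flag is encoded as a pair of lists \<open>([H\<^sub>0, \<dots>, H\<^sub>l], [P\<^sub>1, \<dots>, P\<^sub>l])\<close>, where \<open>P\<^sub>i\<close> is the chosen
  orientation of \<open>H\<^sub>i\<close>; since lists are indexed from 0, \<open>P\<^sub>i\<close> is the entry number \<open>i - 1\<close>.
\<close>

definition M_flag :: "(real ^ 'n) set list \<times> (real ^ 'n) set list \<Rightarrow> bool" where
  "M_flag = (\<lambda>(Hs, Ps).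
     length Hs = length Ps + 1 \<and>
     Hs ! 0 = UNIV \<and>
     (\<forall>H\<in>set Hs. subspace H) \<and>
     (\<forall>i\<in>{1..length Ps}.
        Hs ! i \<subset> Hs ! (i - 1) \<and>
        hyperplane_in (span (Hs ! (i - 1) \<inter> lattice_points)) (Hs ! i) \<and>
        orientation_in (span (Hs ! (i - 1) \<inter> lattice_points)) (Hs ! i) (Ps ! (i - 1))))"

definition M_flags :: "((real ^ 'n) set list \<times> (real ^ 'n) set list) set" where
  "M_flags = {F. M_flag F}"

end

theory Submission
  imports Defs
begin

text \<open>
  Both sides classify the translation-invariant total preorders on the exponent group \<open>M = \<int>\<^sup>n\<close>.

  Addition of Laurent polynomials is idempotent, so a congruence \<open>C\<close> orders its quotient by
  \<open>a \<le> b \<longleftrightarrow> a + b = b\<close>. Primality makes this order total (\<open>cong_le_total\<close>), because the twisted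
  product of \<open>(a + b, a)\<close> and \<open>(a + b, b)\<close> is diagonal. In a totally ordered quotient a sum is the
  maximum of its summands, so a Laurent polynomial is equivalent to its greatest monomial
  (\<open>cong_le_iff_dominated\<close>), and \<open>C\<close> is determined by the preorder it induces on monomials, hence on
  \<open>M\<close>. Conversely, comparing greatest exponents with respect to a total preorder defines a
  prime congruence (\<open>prime_congruence_cone_congruence\<close>).

  A flag gives a preorder lexicographically: a lattice point is positive if the first form that
  does not vanish on it is positive there. Conversely, for a total preorder that does
  not identify all lattice points of a subspace \<open>V\<close>, the nonnegative points lie in a closed
  half-space of the span of \<open>V \<inter> M\<close> (\<open>supporting_form_exists\<close>), and this half-space is unique
  (\<open>supporting_form_pos_imp\<close>). Its boundary is the only possible first hyperplane, and on the
  lattice points of this hyperplane one continues with the restricted preorder; the dimension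
  drops, so the process stops, exactly when all remaining lattice points are equivalent. Existence and
  uniqueness of the half-space both require passing from real to integer coefficients, which
  simultaneous Diophantine approximation provides (\<open>norm_combination_approx\<close>).
\<close>

section \<open>Total preorders on abelian groups\<close>

text \<open>
  A translation-invariant total preorder on the group \<open>G\<close> is encoded by its set
  \<open>N = {x. 0 \<le> x}\<close>, so that \<open>u \<le> v\<close> reads \<open>v - u \<in> N\<close>. Totality also gives \<open>0 \<in> N\<close>.
\<close>

definition total_cone :: "'a::ab_group_add set \<Rightarrow> 'a set \<Rightarrow> bool" where
  "total_cone G N \<longleftrightarrow>
     N \<subseteq> G \<and> (\<forall>x\<in>N. \<forall>y\<in>N. x + y \<in> N) \<and> (\<forall>x\<in>G. x \<in> N \<or> - x \<in> N)"

definition strict_part :: "'a::ab_group_add set \<Rightarrow> 'a set" where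
  "strict_part N = {x \<in> N. - x \<notin> N}"

lemma total_coneD:
  assumes "total_cone G N"
  shows "x \<in> N \<Longrightarrow> x \<in> G" "x \<in> N \<Longrightarrow> y \<in> N \<Longrightarrow> x + y \<in> N" "x \<in> G \<Longrightarrow> x \<in> N \<or> - x \<in> N"
  using assms by (auto simp: total_cone_def)

lemma total_cone_zero:
  assumes "total_cone G N" "0 \<in> G"
  shows "0 \<in> N"
  using total_coneD(3)[OF assms] by simp

lemma strict_part_add:
  assumes "total_cone G N" "x \<in> strict_part N" "y \<in> N"
  shows "x + y \<in> strict_part N"
proof -
  have "- x \<in> N" if "- (x + y) \<in> N"
    using total_coneD(2)[OF assms(1) that assms(3)] by simp
  then show ?thesis
    using assms total_coneD(2)[OF assms(1)] by (auto simp: strict_part_def)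
qed

lemma zero_notin_strict_part: "0 \<notin> strict_part N"
  by (simp add: strict_part_def)

lemma strict_part_scaleR_nat:
  fixes N :: "'v::real_vector set"
  assumes "total_cone G N" "x \<in> strict_part N"
  shows "real (Suc k) *\<^sub>R x \<in> strict_part N"
proof (induction k)
  case (Suc k)
  have "real (Suc (Suc k)) *\<^sub>R x = x + real (Suc k) *\<^sub>R x"
    by (metis add.commute of_nat_Suc scaleR_add_left scaleR_one)
  then show ?case
    using strict_part_add[OF assms] Suc by (simp add: strict_part_def)
qed (use assms in simp)

lemma strict_part_scaleR_int:
  fixes N :: "'v::real_vector set"
  assumes "total_cone G N" "x \<in> strict_part N" "k > (0::int)"
  shows "of_int k *\<^sub>R x \<in> strict_part N"
proof -
  have "real_of_int k = real (Suc (nat k - 1))"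
    using assms(3) by simp
  then show ?thesis
    using strict_part_scaleR_nat[OF assms(1,2)] by metis
qed

lemma strict_part_combination:
  fixes N :: "'v::real_vector set"
  assumes N: "total_cone G N" and "finite F" "F \<noteq> {}" "F \<subseteq> strict_part N"
    and "\<And>v. v \<in> F \<Longrightarrow> h v > (0::int)"
  shows "(\<Sum>v\<in>F. of_int (h v) *\<^sub>R v) \<in> strict_part N"
  using assms(2-)
proof (induction F rule: finite_ne_induct)
  case (singleton v)
  then show ?case
    using strict_part_scaleR_int[OF N] by simp
next
  case (insert v F)
  have "of_int (h v) *\<^sub>R v \<in> strict_part N"
    using insert.prems by (intro strict_part_scaleR_int[OF N]) auto
  moreover have "(\<Sum>v\<in>F. of_int (h v) *\<^sub>R v) \<in> N"
    using insert by (simp add: strict_part_def)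
  ultimately show ?case
    using strict_part_add[OF N] insert.hyps by simp
qed

section \<open>Lattice points and Diophantine approximation\<close>

lemma lattice_points_iff: "(v :: real ^ 'n) \<in> lattice_points \<longleftrightarrow> (\<forall>i. v $ i \<in> \<int>)"
proof
  assume v: "\<forall>i. v $ i \<in> \<int>"
  have "v = (\<chi> i. of_int ((\<chi> i. \<lfloor>v $ i\<rfloor> :: int ^ 'n) $ i))"
    using v by (simp add: vec_eq_iff of_int_floor_cancel)
  then show "v \<in> lattice_points"
    unfolding lattice_points_def by blast
qed (auto simp: lattice_points_def)

lemma lattice_points_add: "u \<in> lattice_points \<Longrightarrow> v \<in> lattice_points \<Longrightarrow> u + v \<in> lattice_points"
  by (simp add: lattice_points_iff)

lemma lattice_points_minus: "- u \<in> lattice_points \<longleftrightarrow> u \<in> lattice_points"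
  by (simp add: lattice_points_iff)

lemma lattice_points_combination:
  assumes "\<And>v. v \<in> F \<Longrightarrow> v \<in> lattice_points"
  shows "(\<Sum>v\<in>F. of_int (h v) *\<^sub>R v) \<in> lattice_points"
  using assms by (auto simp: lattice_points_iff intro!: Ints_sum Ints_mult)

lemma lattice_point_norm_less_1:
  assumes "v \<in> lattice_points" "norm v < 1"
  shows "v = 0"
proof -
  have "v $ i = 0" for i
  proof (rule ccontr)
    assume "v $ i \<noteq> 0"
    then have "\<bar>v $ i\<bar> \<ge> 1"
      using assms(1) by (auto simp: lattice_points_iff intro!: Ints_nonzero_abs_ge1)
    then show False
      using assms(2) component_le_norm_cart[of v i] by linarith
  qed
  then show ?thesis
    by (simp add: vec_eq_iff)
qed

text \<open>
  Simultaneous approximation by fractions with one denominator \<open>k\<close>, indexed by a finite set. It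
  is what replaces real coefficients by integer ones in all that follows; approximating the
  multiples \<open>k a\<^sub>v\<close> to within \<open>e\<close>, and not merely the \<open>a\<^sub>v\<close>, is essential for recognising a
  lattice point close to zero as zero.
\<close>

lemma Dirichlet_approx_finite:
  fixes a :: "'b \<Rightarrow> real"
  assumes "finite F" "e > 0"
  obtains k :: int and h :: "'b \<Rightarrow> int"
  where "k \<ge> 1" "\<And>v. v \<in> F \<Longrightarrow> \<bar>of_int k * a v - of_int (h v)\<bar> < e"
proof -
  obtain g :: "nat \<Rightarrow> 'b" and n where F: "F = g ` {i. i < n}" and inj: "inj_on g {i. i < n}"
    using finite_imp_nat_seg_image_inj_on[OF assms(1)] by metis
  obtain N :: nat where N: "N > 0" "1 / real N < e"
    using real_arch_inverse[of e] assms(2) by (auto simp: divide_inverse)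
  obtain q p where qp: "0 < q" "\<And>i. i < n \<Longrightarrow> \<bar>of_int q * a (g i) - of_int (p i)\<bar> < 1 / N"
    using Dirichlet_approx_simult[OF N(1), where n=n and \<theta>="\<lambda>i. a (g i)"] by metis
  show thesis
  proof (rule that)
    show "q \<ge> 1" using qp by simp
    fix v assume "v \<in> F"
    then obtain i where i: "i < n" "v = g i" by (auto simp: F)
    then have "the_inv_into {i. i < n} g v = i"
      using inj by (simp add: the_inv_into_f_f)
    then show "\<bar>of_int q * a v - of_int ((p \<circ> the_inv_into {i. i < n} g) v)\<bar> < e"
      using qp(2)[OF i(1)] i N by simp
  qed
qed

lemma norm_combination_approx:
  fixes F :: "'v::real_normed_vector set"
  assumes "finite F" "e > 0"
  obtains k :: int and h :: "'v \<Rightarrow> int"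
  where "k \<ge> 1" "\<And>v. v \<in> F \<Longrightarrow> \<bar>of_int k * a v - of_int (h v)\<bar> < e"
    "norm ((\<Sum>v\<in>F. of_int (h v) *\<^sub>R v) - of_int k *\<^sub>R (\<Sum>v\<in>F. a v *\<^sub>R v)) < e"
proof -
  define B where "B = (\<Sum>v\<in>F. norm v)"
  have B: "B \<ge> 0" by (simp add: B_def sum_nonneg)
  define d where "d = e / (B + 1)"
  have d: "d > 0" "d \<le> e" "d * B < e"
    using assms B by (auto simp: d_def field_simps)
  obtain k h where kh: "k \<ge> (1::int)" "\<And>v. v \<in> F \<Longrightarrow> \<bar>of_int k * a v - of_int (h v :: int)\<bar> < d"
    using Dirichlet_approx_finite[OF assms(1) d(1)] by metis
  have "norm ((\<Sum>v\<in>F. of_int (h v) *\<^sub>R v) - of_int k *\<^sub>R (\<Sum>v\<in>F. a v *\<^sub>R v))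
      = norm (\<Sum>v\<in>F. (of_int (h v) - of_int k * a v) *\<^sub>R v)"
    by (simp add: scaleR_sum_right sum_subtractf algebra_simps)
  also have "\<dots> \<le> (\<Sum>v\<in>F. d * norm v)"
  proof (rule sum_norm_le)
    fix v assume "v \<in> F"
    then show "norm ((of_int (h v) - of_int k * a v) *\<^sub>R v) \<le> d * norm v"
      using kh(2)[of v] by (auto intro!: mult_right_mono)
  qed
  also have "\<dots> < e"
    using d by (simp add: B_def sum_distrib_left)
  finally show thesis
    using that[of k h] kh d by fastforce
qed

text \<open>
  A real convex combination \<open>\<Sum> a\<^sub>v v = 0\<close> of strictly positive lattice points would yield one with
  positive integer coefficients: approximate \<open>k a\<^sub>v\<close> by integers \<open>h\<^sub>v\<close> so well that the lattice point
  \<open>\<Sum> h\<^sub>v v\<close> has norm less than \<open>1\<close>, hence vanishes. But a nonempty sum of strictly positive elements is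
  strictly positive.
\<close>

lemma zero_notin_hull_strict_part:
  assumes N: "total_cone (V \<inter> lattice_points) N"
  shows "(0 :: real ^ 'n) \<notin> convex hull (strict_part N)"
proof
  assume "0 \<in> convex hull (strict_part N)"
  then obtain S a where S: "finite S" "S \<subseteq> strict_part N" "\<forall>x\<in>S. 0 \<le> a x"
    "sum a S = 1" "(\<Sum>v\<in>S. a v *\<^sub>R v) = 0"
    unfolding convex_hull_explicit by blast
  define F where "F = {v \<in> S. a v > 0}"
  have F: "finite F" "F \<subseteq> strict_part N" using S by (auto simp: F_def)
  have "F \<noteq> {}"
  proof
    assume "F = {}"
    then have "\<forall>v\<in>S. a v = 0" using S(3) by (force simp: F_def)
    then have "sum a S = 0" by simp
    then show False using S by simp
  qed
  have a0: "(\<Sum>v\<in>F. a v *\<^sub>R v) = 0"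
  proof -
    have "(\<Sum>v\<in>F. a v *\<^sub>R v) = (\<Sum>v\<in>S. a v *\<^sub>R v)"
      using S(1,3) by (intro sum.mono_neutral_left) (auto simp: F_def less_le)
    then show ?thesis using S(5) by simp
  qed
  \<comment> \<open>With this tolerance every \<open>h\<^sub>v\<close> is positive, because \<open>k a\<^sub>v \<ge> a\<^sub>v \<ge> e\<close>.\<close>
  define e where "e = Min (insert 1 (a ` F))"
  have e: "e > 0" "e \<le> 1" "\<And>v. v \<in> F \<Longrightarrow> e \<le> a v"
    using F by (auto simp: e_def F_def)
  obtain k h where kh: "k \<ge> (1::int)" "\<And>v. v \<in> F \<Longrightarrow> \<bar>of_int k * a v - of_int (h v :: int)\<bar> < e"
    "norm ((\<Sum>v\<in>F. of_int (h v) *\<^sub>R v) - of_int k *\<^sub>R (\<Sum>v\<in>F. a v *\<^sub>R v)) < e"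
    by (rule norm_combination_approx[OF F(1) e(1), of a]) (blast intro: that)
  have "h v > 0" if "v \<in> F" for v
  proof -
    have "of_int k * a v \<ge> 1 * a v"
      using kh(1) that by (intro mult_right_mono) (auto simp: F_def)
    then have "real_of_int (h v) > 0"
      using kh(2)[OF that] e(3)[OF that] by linarith
    then show ?thesis by simp
  qed
  then have *: "(\<Sum>v\<in>F. of_int (h v) *\<^sub>R v) \<in> strict_part N"
    using strict_part_combination[OF N F(1) \<open>F \<noteq> {}\<close> F(2)] by blast
  then have "(\<Sum>v\<in>F. of_int (h v) *\<^sub>R v) = 0"
    using kh(3) e a0 total_coneD(1)[OF N] by (intro lattice_point_norm_less_1) (auto simp: strict_part_def)
  then show False
    using * zero_notin_strict_part by metis
qed

text \<open>
  Rational points are dense in a subspace spanned by lattice points, and a positive multiple of a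
  rational point is a lattice point.
\<close>

lemma lattice_point_in_open_cone:
  fixes V :: "(real ^ 'n) set"
  assumes V: "subspace V" and "open U" "\<And>x c. x \<in> U \<Longrightarrow> c > 0 \<Longrightarrow> c *\<^sub>R x \<in> U"
    and w: "w \<in> U" "w \<in> span (V \<inter> lattice_points)"
  shows "\<exists>u\<in>V \<inter> lattice_points. u \<in> U"
proof -
  obtain e where e: "e > 0" "ball w e \<subseteq> U"
    using assms(2) w(1) by (meson openE)
  obtain F a where F: "finite F" "F \<subseteq> V \<inter> lattice_points" "w = (\<Sum>v\<in>F. a v *\<^sub>R v)"
    using w(2) unfolding span_explicit by blast
  obtain k h where kh: "k \<ge> (1::int)" "\<And>v. v \<in> F \<Longrightarrow> \<bar>of_int k * a v - of_int (h v :: int)\<bar> < e"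
    "norm ((\<Sum>v\<in>F. of_int (h v) *\<^sub>R v) - of_int k *\<^sub>R (\<Sum>v\<in>F. a v *\<^sub>R v)) < e"
    by (rule norm_combination_approx[OF F(1) e(1), of a]) (blast intro: that)
  define u where "u = (\<Sum>v\<in>F. of_int (h v) *\<^sub>R v)"
  have "u \<in> V"
    unfolding u_def using F V by (intro subspace_sum subspace_scale) auto
  moreover have "u \<in> lattice_points"
    unfolding u_def using F by (intro lattice_points_combination) auto
  moreover have "u \<in> U"
  proof -
    define k' where "k' = real_of_int k"
    have k': "k' \<ge> 1" using kh by (simp add: k'_def)
    have "dist w ((1 / k') *\<^sub>R u) = norm ((1 / k') *\<^sub>R (u - k' *\<^sub>R w))"
      using k' by (simp add: dist_norm norm_minus_commute scaleR_diff_right)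
    also have "\<dots> = (1 / k') * norm (u - k' *\<^sub>R w)"
      using k' by simp
    also have "\<dots> \<le> 1 * norm (u - k' *\<^sub>R w)"
      using k' by (intro mult_right_mono) auto
    also have "\<dots> < e"
      using kh(3) by (simp add: u_def k'_def F(3))
    finally have "(1 / k') *\<^sub>R u \<in> U"
      using e(2) by auto
    then have "k' *\<^sub>R (1 / k') *\<^sub>R u \<in> U"
      using k' by (metis assms(3) zero_less_one order_less_le_trans)
    moreover have "k' *\<^sub>R (1 / k') *\<^sub>R u = u"
      using k' by simp
    ultimately show ?thesis by simp
  qed
  ultimately show ?thesis by blast
qed

section \<open>Supporting half-spaces of a total preorder\<close>

lemma mem_cone_if_form_pos:
  fixes \<phi> :: "real ^ 'n \<Rightarrow> real"
  assumes "total_cone (V \<inter> lattice_points) N" "linear \<phi>"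
    "\<And>u. u \<in> N \<Longrightarrow> \<phi> u \<ge> 0" "u \<in> V \<inter> lattice_points" "\<phi> u > 0"
  shows "u \<in> N"
  using total_coneD(3)[OF assms(1,4)] assms(3)[of "-u"] assms(5) linear_neg[OF assms(2), of u]
  by auto

text \<open>
  Separate \<open>0\<close> from the convex hull of the strictly positive elements, by a vector \<open>a\<close> in their span.
  The elements \<open>u\<close> equivalent to zero need a separate argument: for strictly positive \<open>p\<close> all
  \<open>p + k u\<close> are strictly positive, so \<open>a \<bullet> u\<close> cannot be negative.
\<close>

lemma supporting_form_exists:
  fixes V :: "(real ^ 'n) set"
  assumes V: "subspace V" and N: "total_cone (V \<inter> lattice_points) N" and ne: "N \<noteq> V \<inter> lattice_points"
  shows "\<exists>\<phi> :: real ^ 'n \<Rightarrow> real.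
    linear \<phi> \<and> (\<exists>v\<in>span (V \<inter> lattice_points). \<phi> v \<noteq> 0) \<and> (\<forall>u\<in>N. \<phi> u \<ge> 0)"
proof -
  define P where "P = strict_part N"
  obtain x where "x \<in> V \<inter> lattice_points" "x \<notin> N"
    using ne total_coneD(1)[OF N] by blast
  then have "- x \<in> P"
    using total_coneD(3)[OF N] by (auto simp: P_def strict_part_def)
  then have Pne: "P \<noteq> {}" by blast
  obtain a where a: "a \<in> span (convex hull P)" "a \<noteq> 0" "\<And>x. x \<in> convex hull P \<Longrightarrow> 0 \<le> a \<bullet> x"
    using separating_hyperplane_set_0_inspan[of "convex hull P"] Pne zero_notin_hull_strict_part[OF N]
    by (metis P_def convex_convex_hull convex_hull_eq_empty)
  have pos: "0 \<le> a \<bullet> x" if "x \<in> P" for x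
    using a(3) hull_inc that by metis
  have "P \<subseteq> V \<inter> lattice_points"
    using total_coneD(1)[OF N] by (auto simp: P_def strict_part_def)
  then have aspan: "a \<in> span (V \<inter> lattice_points)"
    using a(1) span_mono[of P "V \<inter> lattice_points"]
      span_minimal[OF convex_hull_subset_span[of P] subspace_span] by blast
  obtain p where p: "p \<in> P" using Pne by blast
  have unit: "a \<bullet> u \<ge> 0" if u: "u \<in> N" "- u \<in> N" for u
  proof (rule ccontr)
    assume neg: "\<not> a \<bullet> u \<ge> 0"
    have mem: "p + real k *\<^sub>R u \<in> P" for k
    proof (induction k)
      case (Suc k)
      have "p + real (Suc k) *\<^sub>R u = (p + real k *\<^sub>R u) + u"
        by (simp add: scaleR_left_distrib)
      then show ?case
        using strict_part_add[OF N Suc[unfolded P_def] u(1)] by (simp add: P_def add.assoc)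
    qed (use p in simp)
    obtain k :: nat where "a \<bullet> p < real k * - (a \<bullet> u)"
      using reals_Archimedean3[of "- (a \<bullet> u)"] neg by auto
    then show False
      using pos[OF mem[of k]] by (simp add: inner_add_right)
  qed
  show ?thesis
  proof (intro exI[of _ "\<lambda>x. a \<bullet> x"] conjI ballI)
    show "linear (\<lambda>x. a \<bullet> x)"
      using bounded_linear_inner_right bounded_linear.linear by blast
    show "\<exists>v\<in>span (V \<inter> lattice_points). a \<bullet> v \<noteq> 0"
      using aspan a(2) by (auto intro!: bexI[of _ a])
    fix u assume "u \<in> N"
    then show "a \<bullet> u \<ge> 0"
      using unit pos by (cases "u \<in> P") (auto simp: P_def strict_part_def)
  qed
qed

text \<open>
  Uniqueness of the supporting half-space. If \<open>\<phi> w > 0\<close> but \<open>\<psi> w \<le> 0\<close>, a small perturbation of \<open>w\<close>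
  satisfies \<open>\<phi> > 0 > \<psi>\<close>, and then so does some lattice point. The form \<open>\<phi>\<close> puts this point into \<open>N\<close>,
  while \<open>\<psi>\<close> keeps it out.
\<close>

lemma supporting_form_pos_imp:
  fixes V :: "(real ^ 'n) set" and \<phi> \<psi> :: "real ^ 'n \<Rightarrow> real"
  defines "W \<equiv> span (V \<inter> lattice_points)"
  assumes V: "subspace V" and N: "total_cone (V \<inter> lattice_points) N"
    and \<phi>: "linear \<phi>" "\<And>u. u \<in> N \<Longrightarrow> \<phi> u \<ge> 0"
    and \<psi>: "linear \<psi>" "\<exists>v\<in>W. \<psi> v \<noteq> 0" "\<And>u. u \<in> N \<Longrightarrow> \<psi> u \<ge> 0"
    and w: "w \<in> W" "\<phi> w > 0"
  shows "\<psi> w > 0"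
proof (rule ccontr)
  assume "\<not> \<psi> w > 0"
  then have w': "\<psi> w \<le> 0" by simp
  have W: "subspace W" by (simp add: W_def)
  obtain v where v: "v \<in> W" "\<psi> v < 0"
  proof -
    obtain v where "v \<in> W" "\<psi> v \<noteq> 0" using \<psi>(2) by blast
    then show thesis
      using that[of v] that[of "- v"] W linear_neg[OF \<psi>(1), of v] subspace_neg
      by (metis linorder_neqE_linordered_idom neg_less_0_iff_less)
  qed
  obtain d where d: "d > 0" "d * \<bar>\<phi> v\<bar> < \<phi> w"
  proof (rule that[of "\<phi> w / (\<bar>\<phi> v\<bar> + 1)"])
    show "\<phi> w / (\<bar>\<phi> v\<bar> + 1) * \<bar>\<phi> v\<bar> < \<phi> w"
      using w(2) by (simp add: field_simps)
  qed (use w(2) in auto)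
  define x where "x = w + d *\<^sub>R v"
  have "d * \<phi> v \<ge> - (d * \<bar>\<phi> v\<bar>)"
    using d(1) abs_ge_minus_self[of "\<phi> v"] mult_left_mono[of "- \<bar>\<phi> v\<bar>" "\<phi> v" d] by simp
  then have "\<phi> x > 0"
    using d by (simp add: x_def linear_add[OF \<phi>(1)] linear_cmul[OF \<phi>(1)])
  moreover have "\<psi> x < 0"
    using d v w' mult_pos_neg[OF d(1) v(2)] by (simp add: x_def linear_add[OF \<psi>(1)] linear_cmul[OF \<psi>(1)])
  moreover have "x \<in> W"
    unfolding x_def using W v w(1) by (intro subspace_add subspace_scale)
  moreover have "open {x. \<phi> x > 0 \<and> \<psi> x < 0}"
    using \<phi>(1) \<psi>(1)
    by (intro open_Collect_conj open_Collect_less continuous_on_const linear_continuous_on)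
      (simp_all add: linear_linear)
  ultimately obtain u where u: "u \<in> V \<inter> lattice_points" "\<phi> u > 0" "\<psi> u < 0"
    using lattice_point_in_open_cone[OF V, of "{x. \<phi> x > 0 \<and> \<psi> x < 0}" x]
    by (auto simp: W_def linear_cmul[OF \<phi>(1)] linear_cmul[OF \<psi>(1)] mult_pos_neg)
  then show False
    using mem_cone_if_form_pos[OF N \<phi> u(1,2)] \<psi>(3) by fastforce
qed

section \<open>Flags and lexicographic preorders\<close>

text \<open>
  Flags that start at an arbitrary subspace \<open>V\<close>. Passing from \<open>V\<close> to its first hyperplane is the step
  on which all inductions below rest, and it needs this generality.
\<close>

inductive flag_from :: "(real ^ 'n) set \<Rightarrow> (real ^ 'n) set list \<Rightarrow> (real ^ 'n) set list \<Rightarrow> bool" where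
  Nil: "subspace V \<Longrightarrow> flag_from V [V] []"
| Cons: "subspace V \<Longrightarrow> orientation_in (span (V \<inter> lattice_points)) H P \<Longrightarrow> flag_from H Hs Ps
    \<Longrightarrow> flag_from V (V # Hs) (P # Ps)"

text \<open>
  The span of \<open>V \<inter> S\<close> stays inside \<open>V\<close>, and the form cutting out \<open>H\<close> is nonzero somewhere on it.
\<close>

lemma orientation_in_imp_psubset:
  assumes V: "subspace V" and o: "orientation_in (span (V \<inter> S)) H P"
  shows "H \<subset> V" "P \<subseteq> V" "subspace H"
proof -
  have W: "span (V \<inter> S) \<subseteq> V" using V by (simp add: span_minimal)
  obtain \<phi> :: "'a \<Rightarrow> real" where \<phi>: "linear \<phi>" "\<exists>v\<in>span (V \<inter> S). \<phi> v \<noteq> 0"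
    "H = {v \<in> span (V \<inter> S). \<phi> v = 0}"
    "P = {v \<in> span (V \<inter> S). \<phi> v > 0} \<or> P = {v \<in> span (V \<inter> S). \<phi> v < 0}"
    using o unfolding orientation_in_def by (elim exE conjE)
  then show "H \<subset> V" "P \<subseteq> V" using W by blast+
  show "subspace H"
    unfolding \<phi>(3) subspace_def
    using linear_0[OF \<phi>(1)] by (auto simp: linear_add[OF \<phi>(1)] linear_cmul[OF \<phi>(1)] span_zero span_add span_scale)
qed

lemma orientation_in_imp_hyperplane_in: "orientation_in V H P \<Longrightarrow> hyperplane_in V H"
  by (auto simp: orientation_in_def hyperplane_in_def)

lemma flag_from_iff:
  "flag_from V Hs Ps \<longleftrightarrow>
     length Hs = length Ps + 1 \<and> Hs ! 0 = V \<and> (\<forall>H\<in>set Hs. subspace H) \<and>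
     (\<forall>i<length Ps. Hs ! Suc i \<subset> Hs ! i \<and>
        hyperplane_in (span (Hs ! i \<inter> lattice_points)) (Hs ! Suc i) \<and>
        orientation_in (span (Hs ! i \<inter> lattice_points)) (Hs ! Suc i) (Ps ! i))"
    (is "_ \<longleftrightarrow> ?R V Hs Ps")
proof
  show "flag_from V Hs Ps \<Longrightarrow> ?R V Hs Ps"
  proof (induction rule: flag_from.induct)
    case (Cons V H P Hs Ps)
    then show ?case
      using orientation_in_imp_psubset[OF Cons.hyps(1,2)] orientation_in_imp_hyperplane_in
      by (auto simp: All_less_Suc2 nth_Cons split: nat.splits)
  qed auto
  show "?R V Hs Ps \<Longrightarrow> flag_from V Hs Ps"
  proof (induction Ps arbitrary: V Hs)
    case Nil
    then show ?case by (cases Hs) (auto intro: flag_from.Nil)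
  next
    case (Cons P Ps)
    then obtain Hs' where Hs: "Hs = V # Hs'" by (cases Hs) auto
    have len: "length Hs' = length Ps + 1" using Cons.prems Hs by simp
    have i: "Hs' ! i \<subset> Hs ! i \<and>
        hyperplane_in (span (Hs ! i \<inter> lattice_points)) (Hs' ! i) \<and>
        orientation_in (span (Hs ! i \<inter> lattice_points)) (Hs' ! i) ((P # Ps) ! i)"
      if "i < Suc (length Ps)" for i
      using Cons.prems that by (simp add: Hs)
    have "flag_from (Hs' ! 0) Hs' Ps"
    proof (rule Cons.IH, intro conjI allI impI)
      fix j assume "j < length Ps"
      then show "Hs' ! Suc j \<subset> Hs' ! j"
        "hyperplane_in (span (Hs' ! j \<inter> lattice_points)) (Hs' ! Suc j)"
        "orientation_in (span (Hs' ! j \<inter> lattice_points)) (Hs' ! Suc j) (Ps ! j)"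
        using i[of "Suc j"] by (auto simp: Hs)
    qed (use Cons.prems len Hs in auto)
    then show ?case
      using i[of 0] Cons.prems unfolding Hs by (intro flag_from.Cons) auto
  qed
qed

lemma M_flag_iff_flag_from: "M_flag (Hs, Ps) \<longleftrightarrow> flag_from UNIV Hs Ps"
proof -
  have "(\<forall>i\<in>{1..length Ps}. Q i (i - 1)) \<longleftrightarrow> (\<forall>i<length Ps. Q (Suc i) i)" for Q :: "nat \<Rightarrow> nat \<Rightarrow> bool"
  proof -
    have "{1..length Ps} = Suc ` {..<length Ps}"
      by (simp add: image_Suc_lessThan)
    then show ?thesis by auto
  qed
  from this[of "\<lambda>i j. Hs ! i \<subset> Hs ! j \<and>
        hyperplane_in (span (Hs ! j \<inter> lattice_points)) (Hs ! i) \<and>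
        orientation_in (span (Hs ! j \<inter> lattice_points)) (Hs ! i) (Ps ! j)"]
  show ?thesis
    unfolding M_flag_def flag_from_iff by (simp only: prod.case)
qed

text \<open>
  The lexicographic preorder of the flag: a lattice point is nonnegative if it is positive for the
  first linear form of the flag that does not vanish on it, or if no form sees it. As the sets
  \<open>P\<^sub>i \<subseteq> H\<^sub>i\<^sub>-\<^sub>1\<close> already know where the earlier forms vanish, this is a plain union.
\<close>

definition flag_cone :: "(real ^ 'n) set list \<Rightarrow> (real ^ 'n) set list \<Rightarrow> (real ^ 'n) set" where
  "flag_cone Hs Ps = (last Hs \<union> \<Union> (set Ps)) \<inter> lattice_points"

lemma flag_cone_Nil: "flag_cone [V] [] = V \<inter> lattice_points"
  by (simp add: flag_cone_def)

lemma flag_cone_Cons: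
  "flag_from H Hs Ps \<Longrightarrow> flag_cone (V # Hs) (P # Ps) = P \<inter> lattice_points \<union> flag_cone Hs Ps"
  by (erule flag_from.cases) (auto simp: flag_cone_def)

lemma orientation_in_form:
  assumes "orientation_in W H P"
  obtains \<phi> :: "'v::real_vector \<Rightarrow> real"
  where "linear \<phi>" "\<exists>v\<in>W. \<phi> v \<noteq> 0" "H = {v \<in> W. \<phi> v = 0}" "P = {v \<in> W. \<phi> v > 0}"
proof -
  obtain \<phi> :: "'v \<Rightarrow> real" where \<phi>: "linear \<phi>" "\<exists>v\<in>W. \<phi> v \<noteq> 0" "H = {v \<in> W. \<phi> v = 0}"
    "P = {v \<in> W. \<phi> v > 0} \<or> P = {v \<in> W. \<phi> v < 0}"
    using assms unfolding orientation_in_def by (elim exE conjE)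
  from \<phi>(4) show thesis
  proof
    assume "P = {v \<in> W. \<phi> v < 0}"
    then show thesis
      using \<phi> by (intro that[of "\<lambda>v. - \<phi> v"] linear_compose_neg) auto
  qed (use \<phi> that in blast)
qed

lemma total_cone_flag_cone:
  "flag_from V Hs Ps \<Longrightarrow> total_cone (V \<inter> lattice_points) (flag_cone Hs Ps)"
proof (induction rule: flag_from.induct)
  case (Nil V)
  then show ?case
    by (auto simp: flag_cone_Nil total_cone_def lattice_points_add subspace_add)
next
  case (Cons V H P Hs Ps)
  obtain \<phi> :: "real ^ 'a \<Rightarrow> real" where \<phi>: "linear \<phi>" and H: "H = {v \<in> span (V \<inter> lattice_points). \<phi> v = 0}"
    and P: "P = {v \<in> span (V \<inter> lattice_points). \<phi> v > 0}"
    by (rule orientation_in_form[OF Cons.hyps(2)]) (rule that)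
  note N' = total_coneD[OF Cons.IH]
  have W: "v \<in> V" if "v \<in> span (V \<inter> lattice_points)" for v
    using that span_minimal[of "V \<inter> lattice_points" V] Cons.hyps(1) by blast
  show ?case
    unfolding flag_cone_Cons[OF Cons.hyps(3)] total_cone_def
  proof (intro conjI ballI)
    show "P \<inter> lattice_points \<union> flag_cone Hs Ps \<subseteq> V \<inter> lattice_points"
      using N'(1) W by (auto simp: P H)
    fix x y assume xy: "x \<in> P \<inter> lattice_points \<union> flag_cone Hs Ps" "y \<in> P \<inter> lattice_points \<union> flag_cone Hs Ps"
    show "x + y \<in> P \<inter> lattice_points \<union> flag_cone Hs Ps"
    proof (cases "x \<in> flag_cone Hs Ps \<and> y \<in> flag_cone Hs Ps")
      case False
      then have "x + y \<in> P \<inter> lattice_points"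
        using xy N'(1)[of x] N'(1)[of y]
        by (auto simp: P H lattice_points_add linear_add[OF \<phi>] intro: span_add)
      then show ?thesis by blast
    qed (use N'(2) in auto)
  next
    fix x assume x: "x \<in> V \<inter> lattice_points"
    then have xW: "x \<in> span (V \<inter> lattice_points)" by (rule span_base)
    consider "\<phi> x > 0" | "\<phi> x < 0" | "\<phi> x = 0" by linarith
    then show "x \<in> P \<inter> lattice_points \<union> flag_cone Hs Ps \<or> - x \<in> P \<inter> lattice_points \<union> flag_cone Hs Ps"
      using N'(3)[of x] x xW
      by cases (auto simp: P H lattice_points_minus linear_neg[OF \<phi>] intro: span_neg)
  qed
qed

text \<open>
  A nonzero linear form on the span of \<open>V \<inter> M\<close> is nonzero at some lattice point \<open>u\<close> of \<open>V\<close>, and one of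
  \<open>u\<close>, \<open>- u\<close> is then negative. So the cone shows whether a flag stops at \<open>V\<close>.
\<close>

lemma flag_cone_proper:
  assumes "flag_from V (V # Hs) (P # Ps)"
  shows "flag_cone (V # Hs) (P # Ps) \<noteq> V \<inter> lattice_points"
proof -
  obtain H where V: "subspace V" and o: "orientation_in (span (V \<inter> lattice_points)) H P" and f: "flag_from H Hs Ps"
    using assms by cases auto
  obtain \<phi> :: "real ^ 'a \<Rightarrow> real" where \<phi>: "linear \<phi>" "\<exists>v\<in>span (V \<inter> lattice_points). \<phi> v \<noteq> 0"
    and H: "H = {v \<in> span (V \<inter> lattice_points). \<phi> v = 0}"
    and P: "P = {v \<in> span (V \<inter> lattice_points). \<phi> v > 0}"
    by (rule orientation_in_form[OF o]) (rule that)
  obtain u where u: "u \<in> V \<inter> lattice_points" "\<phi> u \<noteq> 0"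
    using \<phi> linear_eq_0_on_span[OF \<phi>(1)] by blast
  have neg: "v \<notin> flag_cone (V # Hs) (P # Ps)" if "\<phi> v < 0" for v
    using that total_coneD(1)[OF total_cone_flag_cone[OF f]]
    by (auto simp: flag_cone_Cons[OF f] H P)
  have "- u \<in> V \<inter> lattice_points"
    using u V by (auto simp: lattice_points_minus subspace_neg)
  then show ?thesis
    using u neg[of u] neg[of "- u"] by (auto simp: linear_neg[OF \<phi>(1)] neq_iff)
qed

text \<open>
  Both first forms are nonnegative on the common cone \<open>N\<close>, so they define the same oriented hyperplane
  \<open>H\<close>; the tails of both flags have the cone \<open>N \<inter> H\<close>, and induction applies.
\<close>

lemma flag_cone_inj:
  "flag_from V Hs Ps \<Longrightarrow> flag_from V Hs' Ps' \<Longrightarrow> flag_cone Hs Ps = flag_cone Hs' Ps' \<Longrightarrow>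
     Hs = Hs' \<and> Ps = Ps'"
proof (induction arbitrary: Hs' Ps' rule: flag_from.induct)
  case (Nil V)
  from Nil(2) show ?case
  proof cases
    case (Cons H P Hs Ps)
    then show ?thesis using Nil flag_cone_proper[of V Hs P Ps] by (simp add: flag_cone_Nil)
  qed simp
next
  case (Cons V H P Hs Ps)
  from Cons.prems(1) show ?case
  proof cases
    case Nil
    then show ?thesis
      using flag_cone_proper[OF flag_from.Cons[OF Cons.hyps]] Cons.prems(2) by (simp add: flag_cone_Nil)
  next
    case (Cons H' P' Hs1 Ps1)
    let ?W = "span (V \<inter> lattice_points)"
    define N where "N = flag_cone (V # Hs) (P # Ps)"
    have V: "subspace V" and f: "flag_from H Hs Ps" by fact+
    have f': "flag_from H' Hs1 Ps1" by fact
    have N1: "N = P \<inter> lattice_points \<union> flag_cone Hs Ps"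
      unfolding N_def by (rule flag_cone_Cons[OF f])
    have N2: "N = P' \<inter> lattice_points \<union> flag_cone Hs1 Ps1"
      unfolding N_def Cons.prems(2) by (simp add: Cons flag_cone_Cons[OF f'])
    have N: "total_cone (V \<inter> lattice_points) N"
      unfolding N_def by (rule total_cone_flag_cone, rule flag_from.Cons) fact+
    have sub: "flag_cone Hs Ps \<subseteq> H" "flag_cone Hs1 Ps1 \<subseteq> H'"
      using total_coneD(1)[OF total_cone_flag_cone[OF f]] total_coneD(1)[OF total_cone_flag_cone[OF f']]
      by blast+
    obtain \<phi> :: "real ^ 'a \<Rightarrow> real" where \<phi>: "linear \<phi>" "\<exists>v\<in>?W. \<phi> v \<noteq> 0"
      and H: "H = {v \<in> ?W. \<phi> v = 0}" and P: "P = {v \<in> ?W. \<phi> v > 0}"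
      by (rule orientation_in_form[OF Cons.hyps(2)]) (rule that)
    obtain \<psi> :: "real ^ 'a \<Rightarrow> real" where \<psi>: "linear \<psi>" "\<exists>v\<in>?W. \<psi> v \<noteq> 0"
      and H': "H' = {v \<in> ?W. \<psi> v = 0}" and P': "P' = {v \<in> ?W. \<psi> v > 0}"
      by (rule orientation_in_form[OF Cons(4)]) (rule that)
    have n\<phi>: "\<phi> u \<ge> 0" if "u \<in> N" for u using that sub by (auto simp: N1 P H)
    have n\<psi>: "\<psi> u \<ge> 0" if "u \<in> N" for u using that sub by (auto simp: N2 P' H')
    have pos: "\<phi> w > 0 \<longleftrightarrow> \<psi> w > 0" if "w \<in> ?W" for w
      using supporting_form_pos_imp[OF V N \<phi>(1) n\<phi> \<psi> n\<psi> that]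
        supporting_form_pos_imp[OF V N \<psi>(1) n\<psi> \<phi> n\<phi> that] by blast
    have "P = P'" using pos by (auto simp: P P')
    have zero: "\<phi> w = 0 \<longleftrightarrow> \<psi> w = 0" if "w \<in> ?W" for w
      using pos[OF that] pos[OF span_neg[OF that]]
      by (auto simp: linear_neg[OF \<phi>(1)] linear_neg[OF \<psi>(1)] neq_iff)
    have "H = H'" using zero by (auto simp: H H')
    have "flag_cone Hs Ps = N \<inter> H" using sub by (auto simp: N1 P H)
    moreover have "flag_cone Hs1 Ps1 = N \<inter> H'" using sub by (auto simp: N2 P' H')
    ultimately have "Hs = Hs1 \<and> Ps = Ps1"
      using Cons.IH[of Hs1 Ps1] f' \<open>H = H'\<close> by simp
    then show ?thesis using Cons \<open>P = P'\<close> by simp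
  qed
qed

text \<open>
  If \<open>N\<close> is everything, the flag stops. Otherwise a supporting form of \<open>N\<close> gives the first oriented
  hyperplane \<open>H\<close>, and the cone \<open>N \<inter> H\<close> comes from a flag that starts at \<open>H\<close>, by induction on the
  dimension.
\<close>

lemma flag_cone_surj:
  "subspace V \<Longrightarrow> total_cone (V \<inter> lattice_points) N \<Longrightarrow> \<exists>Hs Ps. flag_from V Hs Ps \<and> flag_cone Hs Ps = N"
proof (induction "dim V" arbitrary: V N rule: less_induct)
  case less
  note V = less.prems(1) and N = less.prems(2)
  let ?W = "span (V \<inter> lattice_points)"
  show ?case
  proof (cases "N = V \<inter> lattice_points")
    case True
    then show ?thesis using flag_from.Nil[OF V] flag_cone_Nil by blast
  next
    case False
    obtain \<phi> :: "real ^ 'a \<Rightarrow> real" where \<phi>: "linear \<phi>" "\<exists>v\<in>?W. \<phi> v \<noteq> 0" "\<And>u. u \<in> N \<Longrightarrow> \<phi> u \<ge> 0"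
      using supporting_form_exists[OF V N False] by blast
    define H where "H = {v \<in> ?W. \<phi> v = 0}"
    define P where "P = {v \<in> ?W. \<phi> v > 0}"
    have o: "orientation_in ?W H P"
      unfolding orientation_in_def H_def P_def using \<phi> by blast
    note HV = orientation_in_imp_psubset[OF V o]
    have "total_cone (H \<inter> lattice_points) (N \<inter> H)"
      unfolding total_cone_def
      using HV total_coneD[OF N] subspace_add[OF HV(3)] subspace_neg[OF HV(3)] by blast
    moreover have "dim H < dim V"
      using HV V by (metis dim_psubset span_eq_iff)
    ultimately obtain Hs Ps where f: "flag_from H Hs Ps" "flag_cone Hs Ps = N \<inter> H"
      using less.hyps HV(3) by metis
    have "P \<inter> lattice_points \<union> N \<inter> H = N"
    proof (intro equalityI subsetI)
      fix u assume "u \<in> P \<inter> lattice_points \<union> N \<inter> H"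
      then show "u \<in> N"
        using mem_cone_if_form_pos[OF N \<phi>(1,3), of u] HV(2) by (auto simp: P_def)
    next
      fix u assume u: "u \<in> N"
      then have "u \<in> V \<inter> lattice_points" by (rule total_coneD(1)[OF N])
      then show "u \<in> P \<inter> lattice_points \<union> N \<inter> H"
        using u \<phi>(3)[OF u] by (auto simp: P_def H_def less_le span_base)
    qed
    then show ?thesis
      using flag_from.Cons[OF V o f(1)] flag_cone_Cons[OF f(1)] f(2) by metis
  qed
qed

lemma bij_betw_flag_cone:
  "bij_betw (\<lambda>(Hs, Ps). flag_cone Hs Ps) M_flags {N :: (real ^ 'n) set. total_cone lattice_points N}"
proof (rule bij_betw_imageI)
  show "inj_on (\<lambda>(Hs, Ps). flag_cone Hs Ps) M_flags"
    by (auto simp: inj_on_def M_flags_def M_flag_iff_flag_from dest: flag_cone_inj)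
  show "(\<lambda>(Hs, Ps). flag_cone Hs Ps) ` M_flags = {N :: (real ^ 'n) set. total_cone lattice_points N}"
    using total_cone_flag_cone[of UNIV] flag_cone_surj[of UNIV]
    by (force simp: M_flags_def M_flag_iff_flag_from)
qed

section \<open>Prime congruences of idempotent semirings\<close>

text \<open>
  The order \<open>a \<le> b \<longleftrightarrow> a + b = b\<close> of the idempotent quotient semiring by \<open>C\<close>, pulled back to
  representatives.
\<close>

definition cong_le :: "('a::comm_semiring_1 \<times> 'a) set \<Rightarrow> 'a \<Rightarrow> 'a \<Rightarrow> bool" where
  "cong_le C a b \<longleftrightarrow> (a + b, b) \<in> C"

lemma congruenceD:
  assumes "congruence C"
  shows congruence_refl: "(a, a) \<in> C"
    and congruence_sym: "(a, b) \<in> C \<Longrightarrow> (b, a) \<in> C"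
    and congruence_trans: "(a, b) \<in> C \<Longrightarrow> (b, c) \<in> C \<Longrightarrow> (a, c) \<in> C"
    and congruence_add: "(a, b) \<in> C \<Longrightarrow> (c, d) \<in> C \<Longrightarrow> (a + c, b + d) \<in> C"
    and congruence_mult: "(a, b) \<in> C \<Longrightarrow> (c, d) \<in> C \<Longrightarrow> (a * c, b * d) \<in> C"
proof -
  have "equiv UNIV C" using assms by (simp add: congruence_def)
  then show "(a, a) \<in> C" "(a, b) \<in> C \<Longrightarrow> (b, a) \<in> C" "(a, b) \<in> C \<Longrightarrow> (b, c) \<in> C \<Longrightarrow> (a, c) \<in> C"
    by (auto elim!: equivE dest: refl_onD symD transD)
  show "(a, b) \<in> C \<Longrightarrow> (c, d) \<in> C \<Longrightarrow> (a + c, b + d) \<in> C" "(a, b) \<in> C \<Longrightarrow> (c, d) \<in> C \<Longrightarrow> (a * c, b * d) \<in> C"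
    using assms unfolding congruence_def by blast+
qed

lemma cong_le_trans:
  assumes C: "congruence C" and "cong_le C a b" "cong_le C b c"
  shows "cong_le C a c"
proof -
  have "(a + (b + c), a + c) \<in> C" "(a + b + c, b + c) \<in> C"
    using assms congruence_add[OF C] congruence_refl[OF C] by (auto simp: cong_le_def)
  then show ?thesis
    using congruence_sym[OF C] congruence_trans[OF C] assms(3)
    unfolding cong_le_def add.assoc by meson
qed

lemma cong_le_mult: "congruence C \<Longrightarrow> cong_le C a b \<Longrightarrow> cong_le C (c * a) (c * b)"
  unfolding cong_le_def distrib_left[symmetric] by (blast intro: congruence_mult congruence_refl)

lemma cong_le_antisym_iff:
  fixes C :: "('a::comm_semiring_1 \<times> 'a) set"
  assumes C: "congruence C" and idem: "\<And>x::'a. x + x = x"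
  shows "(a, b) \<in> C \<longleftrightarrow> cong_le C a b \<and> cong_le C b a"
proof
  assume ab: "(a, b) \<in> C"
  then show "cong_le C a b \<and> cong_le C b a"
    using congruence_add[OF C ab congruence_refl[OF C, of b]]
      congruence_add[OF C congruence_sym[OF C ab] congruence_refl[OF C, of a]]
    by (simp add: cong_le_def idem)
next
  assume "cong_le C a b \<and> cong_le C b a"
  then show "(a, b) \<in> C"
    using congruence_sym[OF C] congruence_trans[OF C]
    unfolding cong_le_def by (metis add.commute)
qed

text \<open>
  In an idempotent semiring the twisted product of \<open>(a + b, a)\<close> and \<open>(a + b, b)\<close> has both components
  equal to \<open>a\<^sup>2 + ab + b\<^sup>2\<close>, so a prime congruence contains one of the two pairs.
\<close>

lemma cong_le_total:
  fixes C :: "('a::comm_semiring_1 \<times> 'a) set"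
  assumes C: "prime_congruence C" and idem: "\<And>x::'a. x + x = x"
  shows "cong_le C a b \<or> cong_le C b a"
proof (rule ccontr)
  assume "\<not> ?thesis"
  then have "(a + b, a) \<in> - C" "(a + b, b) \<in> - C"
    by (auto simp: cong_le_def add.commute)
  then have "twisted_product (a + b, a) (a + b, b) \<in> - C"
    using C unfolding prime_congruence_def by blast
  moreover have "twisted_product (a + b, a) (a + b, b) = (a * a + a * b + b * b, a * a + a * b + b * b)"
  proof -
    have "(a + b) * (a + b) + a * b = a * a + (a * b + (a * b + a * b)) + b * b"
      "(a + b) * b + a * (a + b) = a * a + (a * b + a * b) + b * b"
      by (simp_all add: algebra_simps)
    then show ?thesis by (simp add: twisted_product_def idem)
  qed
  ultimately show False
    using C congruence_refl unfolding prime_congruence_def by force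
qed

lemma cong_le_add_iff:
  fixes C :: "('a::comm_semiring_1 \<times> 'a) set"
  assumes C: "congruence C" and idem: "\<And>x::'a. x + x = x"
  shows "cong_le C (a + b) c \<longleftrightarrow> cong_le C a c \<and> cong_le C b c"
proof
  have "cong_le C x (x + y)" for x y
    using congruence_refl[OF C] by (simp add: cong_le_def idem add.assoc[symmetric])
  then show "cong_le C (a + b) c \<Longrightarrow> cong_le C a c \<and> cong_le C b c"
    by (metis add.commute cong_le_trans[OF C])
  assume "cong_le C a c \<and> cong_le C b c"
  then have "(a + c + (b + c), c + c) \<in> C"
    unfolding cong_le_def by (blast intro: congruence_add[OF C])
  then show "cong_le C (a + b) c"
    by (metis cong_le_def idem add.commute add.left_commute)
qed

text \<open>
  In a totally ordered quotient the sum \<open>b + c\<close> is the larger of the two summands.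
\<close>

lemma cong_le_add_right_iff:
  fixes C :: "('a::comm_semiring_1 \<times> 'a) set"
  assumes C: "prime_congruence C" and idem: "\<And>x::'a. x + x = x"
  shows "cong_le C a (b + c) \<longleftrightarrow> cong_le C a b \<or> cong_le C a c"
proof
  have C': "congruence C" using C by (simp add: prime_congruence_def)
  have refl: "cong_le C x x" for x
    using congruence_refl[OF C'] by (simp add: cong_le_def idem)
  have "cong_le C (b + c) b \<or> cong_le C (b + c) c"
    using cong_le_total[OF C idem, of b c] refl by (auto simp: cong_le_add_iff[OF C' idem])
  then show "cong_le C a (b + c) \<Longrightarrow> cong_le C a b \<or> cong_le C a c"
    using cong_le_trans[OF C'] by blast
  show "cong_le C a b \<or> cong_le C a c \<Longrightarrow> cong_le C a (b + c)"
    using cong_le_trans[OF C'] refl[of "b + c"] by (auto simp: cong_le_add_iff[OF C' idem])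
qed

lemma cong_le_sum_iff:
  fixes C :: "('a::comm_semiring_1 \<times> 'a) set"
  assumes C: "congruence C" and idem: "\<And>x::'a. x + x = x" and "finite F"
  shows "cong_le C (sum f F) c \<longleftrightarrow> (\<forall>u\<in>F. cong_le C (f u) c)"
  using assms(3)
  by (induction F rule: finite_induct)
    (auto simp: cong_le_add_iff[OF C idem], simp add: cong_le_def congruence_refl[OF C])

lemma cong_le_sum_right_iff:
  fixes C :: "('a::comm_semiring_1 \<times> 'a) set"
  assumes C: "prime_congruence C" and idem: "\<And>x::'a. x + x = x" and "finite F" and "\<not> cong_le C a 0"
  shows "cong_le C a (sum f F) \<longleftrightarrow> (\<exists>u\<in>F. cong_le C a (f u))"
  using assms(3,4)
  by (induction F rule: finite_induct) (auto simp: cong_le_add_right_iff[OF C idem])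

section \<open>Prime congruences on Laurent polynomials\<close>

abbreviation laurent_monomial :: "int ^ 'n \<Rightarrow> 'n boolean_laurent" where
  "laurent_monomial u \<equiv> Poly_Mapping.single u 1"

lemma boolean_laurent_add_idem: "p + p = (p :: 'n::finite boolean_laurent)"
  by (rule injD[OF inj_keys_boolean_laurent]) (simp add: keys_add_boolean_laurent)

lemma boolean_laurent_eq_sum_monomials:
  fixes p :: "'n::finite boolean_laurent"
  shows "p = (\<Sum>u\<in>Poly_Mapping.keys p. laurent_monomial u)"
proof -
  have "Poly_Mapping.keys (\<Sum>u\<in>F. laurent_monomial u :: 'n boolean_laurent) = F" if "finite F" for F
    using that by (induction F rule: finite_induct) (auto simp: keys_add_boolean_laurent)
  then show ?thesis
    by (intro injD[OF inj_keys_boolean_laurent]) simp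
qed

definition nonneg_exponents :: "('n::finite boolean_laurent \<times> 'n boolean_laurent) set \<Rightarrow> (int ^ 'n) set" where
  "nonneg_exponents C = {u. cong_le C 1 (laurent_monomial u)}"

text \<open>
  Monomials are units, so comparing \<open>X\<^sup>u\<close> with \<open>X\<^sup>v\<close> amounts to comparing \<open>1\<close> with \<open>X\<^sup>v\<^sup>-\<^sup>u\<close>.
\<close>

lemma cong_le_monomial_iff:
  fixes C :: "('n::finite boolean_laurent \<times> 'n boolean_laurent) set"
  assumes C: "congruence C"
  shows "cong_le C (laurent_monomial u) (laurent_monomial v) \<longleftrightarrow> v - u \<in> nonneg_exponents C"
  using cong_le_mult[OF C, of "laurent_monomial u" "laurent_monomial v" "laurent_monomial (- u)"]
    cong_le_mult[OF C, of "1" "laurent_monomial (v - u)" "laurent_monomial u"]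
  by (auto simp: nonneg_exponents_def mult_single)

lemma total_cone_nonneg_exponents:
  fixes C :: "('n::finite boolean_laurent \<times> 'n boolean_laurent) set"
  assumes "prime_congruence C"
  shows "total_cone UNIV (nonneg_exponents C)"
proof -
  have C: "congruence C" using assms by (simp add: prime_congruence_def)
  have "u + v \<in> nonneg_exponents C" if "u \<in> nonneg_exponents C" "v \<in> nonneg_exponents C" for u v
    using cong_le_trans[OF C, of 1 "laurent_monomial u" "laurent_monomial (u + v)"] that
      cong_le_monomial_iff[OF C, of u "u + v"]
    by (simp add: nonneg_exponents_def)
  moreover have "u \<in> nonneg_exponents C \<or> - u \<in> nonneg_exponents C" for u
    using cong_le_total[OF assms boolean_laurent_add_idem, of 1 "laurent_monomial u"]
      cong_le_monomial_iff[OF C, of u 0]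
    by (simp add: nonneg_exponents_def)
  ultimately show ?thesis by (simp add: total_cone_def)
qed

text \<open>
  The greatest exponent of \<open>p\<close> is at most the greatest exponent of \<open>q\<close>. The quantifiers spare a
  choice among equivalent greatest exponents and put \<open>0\<close> below everything.
\<close>

definition dominated :: "(int ^ 'n) set \<Rightarrow> 'n boolean_laurent \<Rightarrow> 'n boolean_laurent \<Rightarrow> bool" where
  "dominated N p q \<longleftrightarrow> (\<forall>u\<in>Poly_Mapping.keys p. \<exists>v\<in>Poly_Mapping.keys q. v - u \<in> N)"

definition cone_congruence :: "(int ^ 'n) set \<Rightarrow> ('n boolean_laurent \<times> 'n boolean_laurent) set" where
  "cone_congruence N = {(p, q). dominated N p q \<and> dominated N q p}"

text \<open>
  If a unit were identified with zero, everything would be.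
\<close>

lemma not_cong_le_monomial_zero:
  fixes C :: "('n::finite boolean_laurent \<times> 'n boolean_laurent) set"
  assumes "prime_congruence C"
  shows "\<not> cong_le C (laurent_monomial u) 0"
proof
  have C: "congruence C" using assms by (simp add: prime_congruence_def)
  assume "cong_le C (laurent_monomial u) 0"
  then have "cong_le C p 0" for p
    using cong_le_mult[OF C, of "laurent_monomial u" 0 "p * laurent_monomial (- u)"]
    by (simp add: mult.assoc mult_single)
  then have "(p, 0) \<in> C" for p
    by (simp add: cong_le_def)
  then have "(p, q) \<in> C" for p q
    using congruence_sym[OF C] congruence_trans[OF C] by blast
  then show False
    using assms by (auto simp: prime_congruence_def)
qed

text \<open>
  A Laurent polynomial is the sum of its monomials, that is, their maximum in the quotient. Hence a
  prime congruence is determined by its restriction to monomials.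
\<close>

lemma cong_le_iff_dominated:
  fixes C :: "('n::finite boolean_laurent \<times> 'n boolean_laurent) set"
  assumes "prime_congruence C"
  shows "cong_le C p q \<longleftrightarrow> dominated (nonneg_exponents C) p q"
proof -
  have C: "congruence C" using assms by (simp add: prime_congruence_def)
  have "cong_le C (\<Sum>u\<in>Poly_Mapping.keys p. laurent_monomial u) (\<Sum>v\<in>Poly_Mapping.keys q. laurent_monomial v)
      \<longleftrightarrow> dominated (nonneg_exponents C) p q"
    by (simp add: cong_le_sum_iff[OF C boolean_laurent_add_idem] dominated_def cong_le_monomial_iff[OF C]
        cong_le_sum_right_iff[OF assms boolean_laurent_add_idem finite_keys not_cong_le_monomial_zero[OF assms]])
  then show ?thesis
    using boolean_laurent_eq_sum_monomials by metis
qed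

lemma cone_congruence_nonneg_exponents:
  fixes C :: "('n::finite boolean_laurent \<times> 'n boolean_laurent) set"
  assumes "prime_congruence C"
  shows "cone_congruence (nonneg_exponents C) = C"
proof -
  have C: "congruence C" using assms by (simp add: prime_congruence_def)
  show ?thesis
    by (auto simp: cone_congruence_def cong_le_antisym_iff[OF C boolean_laurent_add_idem]
        cong_le_iff_dominated[OF assms])
qed

lemma dominated_refl: "total_cone UNIV N \<Longrightarrow> dominated N p p"
  using total_cone_zero by (force simp: dominated_def)

lemma dominated_trans:
  assumes "total_cone UNIV N" "dominated N p q" "dominated N q r"
  shows "dominated N p r"
  unfolding dominated_def
proof
  fix u assume "u \<in> Poly_Mapping.keys p"
  then obtain v w where "v - u \<in> N" "w \<in> Poly_Mapping.keys r" "w - v \<in> N"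
    using assms(2,3) unfolding dominated_def by blast
  then show "\<exists>v\<in>Poly_Mapping.keys r. v - u \<in> N"
    using total_coneD(2)[OF assms(1), of "w - v" "v - u"] by auto
qed

lemma dominated_add:
  fixes p q :: "'n::finite boolean_laurent"
  shows "dominated N p q \<Longrightarrow> dominated N p' q' \<Longrightarrow> dominated N (p + p') (q + q')"
  by (auto simp: dominated_def keys_add_boolean_laurent)

lemma dominated_mult:
  fixes p q :: "'n::finite boolean_laurent"
  assumes N: "total_cone UNIV N" and "dominated N p q" "dominated N p' q'"
  shows "dominated N (p * p') (q * q')"
  unfolding dominated_def
proof
  fix w assume "w \<in> Poly_Mapping.keys (p * p')"
  then obtain u u' where w: "w = u + u'" "u \<in> Poly_Mapping.keys p" "u' \<in> Poly_Mapping.keys p'"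
    by (auto simp: keys_mult_boolean_laurent)
  then obtain v v' where v: "v \<in> Poly_Mapping.keys q" "v' \<in> Poly_Mapping.keys q'" "v - u \<in> N" "v' - u' \<in> N"
    using assms(2,3) unfolding dominated_def by blast
  then have "(v + v') - w \<in> N"
    using total_coneD(2)[OF N v(3,4)] by (simp add: w algebra_simps)
  then show "\<exists>v\<in>Poly_Mapping.keys (q * q'). v - w \<in> N"
    using v by (auto simp: keys_mult_boolean_laurent)
qed

lemma total_cone_finite_greatest:
  assumes N: "total_cone UNIV N" and "finite F" "F \<noteq> {}"
  shows "\<exists>w\<in>F. \<forall>u\<in>F. w - u \<in> N"
  using assms(2,3)
proof (induction F rule: finite_ne_induct)
  case (singleton x)
  then show ?case using total_cone_zero[OF N] by simp
next
  case (insert x F)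
  then obtain w where w: "w \<in> F" "\<forall>u\<in>F. w - u \<in> N" by blast
  from total_coneD(3)[OF N, of "w - x"] show ?case
  proof
    assume "- (w - x) \<in> N"
    then have "x - u \<in> N" if "u \<in> F" for u
      using total_coneD(2)[OF N, of "x - w" "w - u"] w that by simp
    then show ?thesis using total_cone_zero[OF N] by auto
  qed (use w in auto)
qed

text \<open>
  An exponent of \<open>p\<close> that lies below no exponent of \<open>q\<close> keeps this property when it is replaced by a
  greatest exponent of \<open>p\<close>.
\<close>

lemma not_dominatedE:
  fixes p q :: "'n::finite boolean_laurent"
  assumes N: "total_cone UNIV N" and "\<not> dominated N p q"
  obtains w where "w \<in> Poly_Mapping.keys p" "\<And>u. u \<in> Poly_Mapping.keys p \<Longrightarrow> w - u \<in> N"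
    "\<And>v. v \<in> Poly_Mapping.keys q \<Longrightarrow> v - w \<notin> N"
proof -
  obtain u where u: "u \<in> Poly_Mapping.keys p" "\<And>v. v \<in> Poly_Mapping.keys q \<Longrightarrow> v - u \<notin> N"
    using assms(2) by (auto simp: dominated_def)
  obtain w where w: "w \<in> Poly_Mapping.keys p" "\<And>u. u \<in> Poly_Mapping.keys p \<Longrightarrow> w - u \<in> N"
    using total_cone_finite_greatest[OF N finite_keys] u(1) by blast
  have "v - w \<notin> N" if "v \<in> Poly_Mapping.keys q" for v
    using total_coneD(2)[OF N, of "v - w" "w - u"] u w that by auto
  then show thesis using that w by blast
qed

text \<open>
  Let \<open>s\<close> and \<open>t\<close> be greatest exponents of \<open>a\<close> and \<open>c\<close>. Every exponent of \<open>b\<close> lies strictly below \<open>s\<close>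
  and every exponent of \<open>d\<close> strictly below \<open>t\<close>, so the exponent \<open>s + t\<close> of \<open>ac\<close> exceeds all exponents
  of \<open>ad + bc\<close>.
\<close>

lemma not_dominated_twisted_product:
  fixes a b c d :: "'n::finite boolean_laurent"
  assumes N: "total_cone UNIV N" and ab: "\<not> dominated N a b" and cd: "\<not> dominated N c d"
  shows "\<not> dominated N (a * c + b * d) (a * d + b * c)"
proof
  obtain s where s: "s \<in> Poly_Mapping.keys a" "\<And>u. u \<in> Poly_Mapping.keys a \<Longrightarrow> s - u \<in> N"
    "\<And>v. v \<in> Poly_Mapping.keys b \<Longrightarrow> v - s \<notin> N"
    using not_dominatedE[OF N ab] by blast
  obtain t where t: "t \<in> Poly_Mapping.keys c" "\<And>u. u \<in> Poly_Mapping.keys c \<Longrightarrow> t - u \<in> N"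
    "\<And>v. v \<in> Poly_Mapping.keys d \<Longrightarrow> v - t \<notin> N"
    using not_dominatedE[OF N cd] by blast
  have "s + t \<in> Poly_Mapping.keys (a * c + b * d)"
    using s(1) t(1) by (auto simp: keys_add_boolean_laurent keys_mult_boolean_laurent)
  moreover assume "dominated N (a * c + b * d) (a * d + b * c)"
  ultimately obtain w where w: "w \<in> Poly_Mapping.keys (a * d + b * c)" "w - (s + t) \<in> N"
    unfolding dominated_def by blast
  from w(1) consider x y where "w = x + y" "x \<in> Poly_Mapping.keys a" "y \<in> Poly_Mapping.keys d"
    | x y where "w = x + y" "x \<in> Poly_Mapping.keys b" "y \<in> Poly_Mapping.keys c"
    by (auto simp: keys_add_boolean_laurent keys_mult_boolean_laurent)
  then show False
  proof cases
    case (1 x y)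
    then have "y - t \<in> N"
      using total_coneD(2)[OF N w(2) s(2)[of x]] by (simp add: algebra_simps)
    then show False using t(3) 1 by blast
  next
    case (2 x y)
    then have "x - s \<in> N"
      using total_coneD(2)[OF N w(2) t(2)[of y]] by (simp add: algebra_simps)
    then show False using s(3) 2 by blast
  qed
qed

lemma prime_congruence_cone_congruence:
  fixes N :: "(int ^ 'n::finite) set"
  assumes N: "total_cone UNIV N"
  shows "prime_congruence (cone_congruence N)"
  unfolding prime_congruence_def
proof (intro conjI ballI)
  show "congruence (cone_congruence N)"
    unfolding congruence_def
    using dominated_refl[OF N] dominated_trans[OF N] dominated_mult[OF N] dominated_add[of N]
    by (auto simp: cone_congruence_def intro!: equivI refl_onI symI transI)
  have "(1, 0) \<notin> cone_congruence N"
    by (simp add: cone_congruence_def dominated_def)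
  then show "- cone_congruence N \<noteq> {}" by blast
  fix x y assume "x \<in> - cone_congruence N" "y \<in> - cone_congruence N"
  moreover obtain a b c d where "x = (a, b)" "y = (c, d)" by fastforce
  \<comment> \<open>Each of the two pairs can fail in either direction; swapping a pair swaps the twisted product.\<close>
  moreover note not_dominated_twisted_product[OF N, of a b c d] not_dominated_twisted_product[OF N, of a b d c]
    not_dominated_twisted_product[OF N, of b a c d] not_dominated_twisted_product[OF N, of b a d c]
  ultimately show "twisted_product x y \<in> - cone_congruence N"
    by (auto simp: twisted_product_def cone_congruence_def add.commute)
qed

lemma nonneg_exponents_cone_congruence:
  fixes N :: "(int ^ 'n::finite) set"
  assumes N: "total_cone UNIV N"
  shows "nonneg_exponents (cone_congruence N) = N"
  using total_cone_zero[OF N]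
  by (auto simp: nonneg_exponents_def cong_le_def cone_congruence_def dominated_def keys_add_boolean_laurent)

lemma bij_betw_nonneg_exponents:
  "bij_betw nonneg_exponents (CSpec :: ('n::finite boolean_laurent \<times> 'n boolean_laurent) set set)
     {N. total_cone UNIV N}"
  by (rule bij_betw_byWitness[where f' = cone_congruence])
    (auto simp: CSpec_def cone_congruence_nonneg_exponents nonneg_exponents_cone_congruence
      total_cone_nonneg_exponents prime_congruence_cone_congruence)

section \<open>The bijection\<close>

lemma bij_betw_image_total_cone:
  fixes f :: "'a::ab_group_add \<Rightarrow> 'b::ab_group_add"
  assumes inj: "inj f" and add: "\<And>x y. f (x + y) = f x + f y"
  shows "bij_betw ((`) f) {N. total_cone UNIV N} {N. total_cone (range f) N}"
proof (rule bij_betw_imageI)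
  show "inj_on ((`) f) {N. total_cone UNIV N}"
    using inj by (simp add: inj_on_def inj_image_eq_iff)
  interpret f: additive f by standard (rule add)
  have mem: "f x \<in> f ` N \<longleftrightarrow> x \<in> N" for x N
    using inj by (rule inj_image_mem_iff)
  have iff: "total_cone (range f) (f ` N) \<longleftrightarrow> total_cone UNIV N" for N
    unfolding total_cone_def by (simp add: image_mono mem add[symmetric] f.minus[symmetric])
  show "(`) f ` {N. total_cone UNIV N} = {N. total_cone (range f) N}"
  proof (intro equalityI subsetI)
    fix N assume N: "N \<in> {N. total_cone (range f) N}"
    then obtain N' where "N = f ` N'"
      by (auto simp: total_cone_def subset_image_iff)
    then show "N \<in> (`) f ` {N. total_cone UNIV N}" using N iff by auto
  qed (use iff in auto)
qed

lemma bij_betw_real_total_cones: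
  "\<exists>g. bij_betw g {N :: (int ^ 'n) set. total_cone UNIV N} {N :: (real ^ 'n) set. total_cone lattice_points N}"
proof -
  have "bij_betw ((`) (\<lambda>u :: int ^ 'n. \<chi> i. real_of_int (u $ i))) {N. total_cone UNIV N} {N. total_cone lattice_points N}"
    unfolding lattice_points_def
    by (rule bij_betw_image_total_cone) (auto simp: inj_def vec_eq_iff)
  then show ?thesis by blast
qed

theorem theorem5p6:
  shows "\<exists>f. bij_betw f
    (CSpec :: ('n::finite boolean_laurent \<times> 'n boolean_laurent) set set)
    (M_flags :: ((real ^ 'n) set list \<times> (real ^ 'n) set list) set)"
proof -
  obtain g where g: "bij_betw g {N :: (int ^ 'n) set. total_cone UNIV N} {N :: (real ^ 'n) set. total_cone lattice_points N}"
    using bij_betw_real_total_cones by blast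
  show ?thesis
    using bij_betw_trans[OF bij_betw_trans[OF bij_betw_nonneg_exponents g] bij_betw_inv_into[OF bij_betw_flag_cone]]
    by blast
qed

end
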